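(* Let $j^{\max}$ be a finite natural number, let $\{\psi_i\}_{i\in I}=W(\alpha,\beta)$ be a wave packet system with index set $I$ (as defined in the context), and assume that its parameters satisfy $\kappa_0\geqslant 24$ and $\kappa\geqslant 24$. Let $\rho$ be the distance on $I$ defined in the context. Then for any two elements $\psi_i,\psi_{i'}$ of the system, $i,i'\in I$, $$|\langle \psi_i\,|\,\psi_{i'}\rangle| \lesssim (1+\rho(i,i'))^{-6},$$ i.e. there is a constant $c>0$ such that $|\langle \psi_i\,|\,\psi_{i'}\rangle| \leqslant c\,(1+\rho(i,i'))^{-6}$ for all $i,i'\in I$.
   Context: Notation: $\mathbb N=\{1,2,\dots\}$, $\mathbb N_0=\mathbb N\cup\{0\}$; $\lceil x\rceil$ is the smallest integer $\geqslant x$; $|\cdot|$ is the Euclidean norm on $\mathbb R^2$; $\langle x,y\rangle=x_1y_1+x_2y_2$ for $x,y\in\mathbb R^2$; $\langle f\,|\,g\rangle$ is the $L^2(\mathbb R^2)$ scalar product of functions; $\mathrm i$ is the imaginary unit; $\hat f(\xi)=\int_{\mathbb R^2} f(t)e^{-2\pi \mathrm i\langle t,\xi\rangle}\,dt$. For a multi-index $a=(a_1,a_2)\in\mathbb N_0^2$, $|a|=a_1+a_2$. $f\lesssim g$ means $f\leqslant c\,g$ for some constant $c$ independent of the variables (here: of the point $\xi$, or of the indexes). Index set. Let $0\leqslant\beta\leqslant\alpha<1$, $N:=10$, $j^{\max}\in\mathbb N$, $\delta>0$. For $j\in\mathbb N$ put $l_j^{\max}:=\lceil N\cdot 2^{(1-\beta)j}\rceil-1$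 and, for $l\in\mathbb N_0$, $\theta_{jl}:=2\pi\cdot\frac{2^{(\beta-1)j}}{N}\cdot l$. For $l\leqslant l_j^{\max}$ let $m_{j,l}^{\max}:=\lceil 2^{(1-\alpha)j-1}\rceil-1$ if $j=j^{\max}$ or if $\theta_{jl}=\theta_{j+1,l'}$ for some $l'\in\mathbb N_0$ with $l'\leqslant l_{j+1}^{\max}$, and $m_{j,l}^{\max}:=\lceil 2^{(1-\alpha)j-1}\rceil$ otherwise. The index set is $$I:=\{(0,0,0,k):k\in\mathbb Z^2\}\cup\{(j,m,l,k)\in\mathbb N\times\mathbb N_0\times\mathbb N_0\times\mathbb Z^2: j\leqslant j^{\max},\ l\leqslant l_j^{\max},\ m\leqslant m_{j,l}^{\max}\}.$$ Matrices. $A_j=\begin{pmatrix}2^{\alpha j}&0\\0&2^{\beta j}\end{pmatrix}$, $B_{jm}=\begin{pmatrix}2^{j-1}+m\cdot2^{\alpha j}\\0\end{pmatrix}$, $R_{jl}=\begin{pmatrix}\cos\theta_{jl}&-\sin\theta_{jl}\\ \sin\theta_{jl}&\cos\theta_{jl}\end{pmatrix}$. Wave packet system. Let $p_0\in(0,1]$, $\kappa_0:=10+2p_0^{-1}$, $\epsilon\in(0,1/32)$, and let $\kappa\geqslant10$, $\kappa_1\geqslant2$, $\kappa_2\geqslant10$. Let $\gamma,\psi\in C^1(\mathbb R^2)$ be (complex-valued) prototype functions such that, for $f\in\{\gamma,\psi\}$: (1) $\partial^a f\in L^1(\mathbb R^2)\cap L^\infty(\mathbb R^2)$ for all $a\in\mathbb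 N_0^2$ with $|a|\leqslant1$; (2) $\sup_{t\in\mathbb R^2}(1+|t|)^{\kappa_0}|f(t)|<\infty$; (3) $\hat f\in C^\infty(\mathbb R^2)$, with $\hat\gamma(\xi)\neq0$ for all $\xi$ in the closed ball of radius $4$ centred at $0$, and $\hat\psi(\xi)\neq0$ for all $\xi\in[-\epsilon,1+\epsilon]\times[-1-\epsilon,1+\epsilon]$; (4) $|\partial^a\widehat{\partial^b f}(\xi)|\lesssim(1+|\xi|)^{-\kappa}(1+|\xi_1|)^{-\kappa_1}(1+|\xi_2|)^{-\kappa_2}$ for all $\xi=(\xi_1,\xi_2)\in\mathbb R^2$ and all $a,b\in\mathbb N_0^2$ with $|a|\leqslant12$, $|b|\leqslant1$. For $i=(j,m,l,k)\in I$ define $\psi_i(t):=\gamma(t-\delta k)$ if $(j,m,l)=(0,0,0)$, and $\psi_i(t):=|\det A_j|^{1/2}\,e^{-2\pi\mathrm i\langle R_{jl}B_{jm},t\rangle}\,(\psi\circ A_j\circ R_{jl}^{-1})(t-\delta R_{jl}A_j^{-1}k)$ if $(j,m,l)\neq(0,0,0)$. The set $W(\alpha,\beta):=\{\psi_i\}_{i\in I}$ is called the wave packet system. Distance. For $i=(j,m,l,k)\in I$ put: $r_i:=0$, $\theta_i:=0$, $t_i:=\delta k$ if $(j,m,l)=(0,0,0)$; and $r_i:=2^{j-1}+m\cdot2^{\alpha j}$, $\theta_i:=\theta_{jl}$, $t_i:=\delta R_{jl}A_j^{-1}k$ if $(j,m,l)\neq(0,0,0)$. For $i,i'\in I$, $$\rho(i,i'):=|r_i-r_{i'}|+|\theta_i-\theta_{i'}|+|(t_i-t_{i'})_1|+|(t_i-t_{i'})_2|,$$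 where $(\cdot)_1,(\cdot)_2$ denote the Cartesian components of a vector in $\mathbb R^2$. *)

theory Defs
  imports "HOL-Analysis.Analysis"
begin

definition pdiff :: "2 \<Rightarrow> (real^2 \<Rightarrow> complex) \<Rightarrow> real^2 \<Rightarrow> complex" where
  "pdiff i f x = vector_derivative (\<lambda>s. f (x + s *\<^sub>R axis i 1)) (at 0)"

(* For f with continuous partial derivatives up to order fst a + snd a the order of
   differentiation chosen here is immaterial. *)
definition multi_pdiff :: "nat \<times> nat \<Rightarrow> (real^2 \<Rightarrow> complex) \<Rightarrow> real^2 \<Rightarrow> complex" where
  "multi_pdiff a f = (pdiff 1 ^^ fst a) ((pdiff 2 ^^ snd a) f)"

primrec C_k :: "nat \<Rightarrow> (real^2 \<Rightarrow> complex) \<Rightarrow> bool" where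
  "C_k 0 f \<longleftrightarrow> continuous_on UNIV f"
| "C_k (Suc n) f \<longleftrightarrow> continuous_on UNIV f \<and>
     (\<forall>i. (\<forall>x. (\<lambda>s. f (x + s *\<^sub>R axis i 1)) differentiable (at 0)) \<and> C_k n (pdiff i f))"

definition C_infinity :: "(real^2 \<Rightarrow> complex) \<Rightarrow> bool" where
  "C_infinity f \<longleftrightarrow> (\<forall>n. C_k n f)"

definition L_infinity :: "(real^2 \<Rightarrow> complex) \<Rightarrow> bool" where
  "L_infinity f \<longleftrightarrow> f \<in> borel_measurable lborel \<and> (\<exists>C. AE t in lborel. norm (f t) \<le> C)"

definition fourier :: "(real^2 \<Rightarrow> complex) \<Rightarrow> real^2 \<Rightarrow> complex" where
  "fourier f \<xi> = (LINT t|lborel. f t * exp (- 2 * of_real pi * \<i> * of_real (inner t \<xi>)))"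

definition L2_inner :: "(real^2 \<Rightarrow> complex) \<Rightarrow> (real^2 \<Rightarrow> complex) \<Rightarrow> complex" where
  "L2_inner f g = (LINT t|lborel. f t * cnj (g t))"

definition prototype :: "real \<Rightarrow> real \<Rightarrow> real \<Rightarrow> real \<Rightarrow> (real^2 \<Rightarrow> complex) \<Rightarrow> bool" where
  "prototype \<kappa>\<^sub>0 \<kappa> \<kappa>\<^sub>1 \<kappa>\<^sub>2 f \<longleftrightarrow>
     C_k 1 f \<and>
     (\<forall>a. fst a + snd a \<le> 1 \<longrightarrow>
        integrable lborel (multi_pdiff a f) \<and> L_infinity (multi_pdiff a f)) \<and>
     bdd_above (range (\<lambda>t. (1 + norm t) powr \<kappa>\<^sub>0 * norm (f t))) \<and>
     C_infinity (fourier f) \<and>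
     (\<forall>a b. fst a + snd a \<le> 12 \<longrightarrow> fst b + snd b \<le> 1 \<longrightarrow>
        (\<exists>C. \<forall>\<xi>. norm (multi_pdiff a (fourier (multi_pdiff b f)) \<xi>)
           \<le> C * ((1 + norm \<xi>) powr (- \<kappa>) * (1 + \<bar>\<xi> $ 1\<bar>) powr (- \<kappa>\<^sub>1)
                    * (1 + \<bar>\<xi> $ 2\<bar>) powr (- \<kappa>\<^sub>2))))"

definition N_angles :: real where
  "N_angles = 10"

definition l_max :: "real \<Rightarrow> nat \<Rightarrow> nat" where
  "l_max \<beta> j = nat (\<lceil>N_angles * 2 powr ((1 - \<beta>) * real j)\<rceil> - 1)"

definition angle :: "real \<Rightarrow> nat \<Rightarrow> nat \<Rightarrow> real" where
  "angle \<beta> j l = 2 * pi * (2 powr ((\<beta> - 1) * real j) / N_angles) * real l"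

definition m_max :: "real \<Rightarrow> real \<Rightarrow> nat \<Rightarrow> nat \<Rightarrow> nat \<Rightarrow> nat" where
  "m_max \<alpha> \<beta> jmax j l =
     (if j = jmax \<or> (\<exists>l'. l' \<le> l_max \<beta> (j + 1) \<and> angle \<beta> j l = angle \<beta> (j + 1) l')
      then nat (\<lceil>2 powr ((1 - \<alpha>) * real j - 1)\<rceil> - 1)
      else nat \<lceil>2 powr ((1 - \<alpha>) * real j - 1)\<rceil>)"

(* Indices are quadruples (j, m, l, k): scale, radial position, angle, translation. *)
type_synonym wp_index = "nat \<times> nat \<times> nat \<times> (int^2)"

definition index_set :: "real \<Rightarrow> real \<Rightarrow> nat \<Rightarrow> wp_index set" where
  "index_set \<alpha> \<beta> jmax =
     {(0, 0, 0, k) | k. True} \<union>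
     {(j, m, l, k) | j m l k. 1 \<le> j \<and> j \<le> jmax \<and> l \<le> l_max \<beta> j \<and> m \<le> m_max \<alpha> \<beta> jmax j l}"

definition A_mat :: "real \<Rightarrow> real \<Rightarrow> nat \<Rightarrow> real^2^2" where
  "A_mat \<alpha> \<beta> j = vector [vector [2 powr (\<alpha> * real j), 0], vector [0, 2 powr (\<beta> * real j)]]"

definition B_vec :: "real \<Rightarrow> nat \<Rightarrow> nat \<Rightarrow> real^2" where
  "B_vec \<alpha> j m = vector [2 powr (real j - 1) + real m * 2 powr (\<alpha> * real j), 0]"

definition R_mat :: "real \<Rightarrow> nat \<Rightarrow> nat \<Rightarrow> real^2^2" where
  "R_mat \<beta> j l = vector [vector [cos (angle \<beta> j l), - sin (angle \<beta> j l)],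
                          vector [sin (angle \<beta> j l), cos (angle \<beta> j l)]]"

definition real_vec :: "int^2 \<Rightarrow> real^2" where
  "real_vec k = (\<chi> n. of_int (k $ n))"

definition radius :: "real \<Rightarrow> wp_index \<Rightarrow> real" where
  "radius \<alpha> = (\<lambda>(j, m, l, k).
     if (j, m, l) = (0, 0, 0) then 0
     else 2 powr (real j - 1) + real m * 2 powr (\<alpha> * real j))"

definition orientation :: "real \<Rightarrow> wp_index \<Rightarrow> real" where
  "orientation \<beta> = (\<lambda>(j, m, l, k). if (j, m, l) = (0, 0, 0) then 0 else angle \<beta> j l)"

definition position :: "real \<Rightarrow> real \<Rightarrow> real \<Rightarrow> wp_index \<Rightarrow> real^2" where
  "position \<alpha> \<beta> \<delta> = (\<lambda>(j, m, l, k).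
     if (j, m, l) = (0, 0, 0) then \<delta> *\<^sub>R real_vec k
     else \<delta> *\<^sub>R (R_mat \<beta> j l *v (matrix_inv (A_mat \<alpha> \<beta> j) *v real_vec k)))"

definition wave_packet ::
  "real \<Rightarrow> real \<Rightarrow> real \<Rightarrow> (real^2 \<Rightarrow> complex) \<Rightarrow> (real^2 \<Rightarrow> complex) \<Rightarrow>
     wp_index \<Rightarrow> real^2 \<Rightarrow> complex" where
  "wave_packet \<alpha> \<beta> \<delta> \<gamma> \<psi> = (\<lambda>(j, m, l, k) t.
     if (j, m, l) = (0, 0, 0) then \<gamma> (t - \<delta> *\<^sub>R real_vec k)
     else of_real (sqrt \<bar>det (A_mat \<alpha> \<beta> j)\<bar>)
        * exp (- 2 * of_real pi * \<i> * of_real (inner (R_mat \<beta> j l *v B_vec \<alpha> j m) t))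
        * \<psi> (A_mat \<alpha> \<beta> j *v (matrix_inv (R_mat \<beta> j l) *v
              (t - \<delta> *\<^sub>R (R_mat \<beta> j l *v (matrix_inv (A_mat \<alpha> \<beta> j) *v real_vec k))))))"

definition wp_dist :: "real \<Rightarrow> real \<Rightarrow> real \<Rightarrow> wp_index \<Rightarrow> wp_index \<Rightarrow> real" where
  "wp_dist \<alpha> \<beta> \<delta> i i' =
     \<bar>radius \<alpha> i - radius \<alpha> i'\<bar> + \<bar>orientation \<beta> i - orientation \<beta> i'\<bar>
     + \<bar>(position \<alpha> \<beta> \<delta> i - position \<alpha> \<beta> \<delta> i') $ 1\<bar>
     + \<bar>(position \<alpha> \<beta> \<delta> i - position \<alpha> \<beta> \<delta> i') $ 2\<bar>"

end

theory Submission
  imports Defs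
begin

text \<open>
  Since \<open>jmax\<close> is finite, only finitely many triples \<open>(j, m, l)\<close> occur, so the radial and angular
  parts of the distance are bounded and the constant may depend on \<open>(j, m, l)\<close>. What has to be
  controlled is the dependence on the translations \<open>k\<close>. A packet is a linear image of a prototype,
  translated to its position, so it keeps the polynomial decay around that position. As
  \<open>1 + \<bar>u - v\<bar> \<le> 2 max (1 + \<bar>t - u\<bar>) (1 + \<bar>t - v\<bar>)\<close>, for each \<open>t\<close> the decay of one of the two packets
  absorbs the sixth power of the distance, and the other packet is integrable.
\<close>

section \<open>Integrability under translations and linear maps\<close>

lemma integrable_lborel_translation:
  fixes f :: "'a::euclidean_space \<Rightarrow> real"
  assumes "integrable lborel f"
  shows "integrable lborel (\<lambda>t. f (t - u))"
    and "(LINT t|lborel. f (t - u)) = (LINT t|lborel. f t)"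
proof -
  have [measurable]: "f \<in> borel_measurable borel"
    using borel_measurable_integrable[OF assms] by simp
  have d: "distr lborel borel ((+) (- u)) = lborel"
    by (rule lborel_distr_plus)
  have "integrable (distr lborel borel ((+) (- u))) f"
    using assms by (simp add: d)
  then show "integrable lborel (\<lambda>t. f (t - u))"
    by (subst (asm) integrable_distr_eq) (auto simp: algebra_simps)
  have "(LINT t|distr lborel borel ((+) (- u)). f t) = (LINT t|lborel. f (- u + t))"
    by (rule integral_distr) auto
  then show "(LINT t|lborel. f (t - u)) = (LINT t|lborel. f t)"
    by (simp add: d algebra_simps)
qed

text \<open>The linear change of variables is stated for maps into \<open>real^n\<close>, so
  \<open>f\<close> makes a detour through \<open>real^1\<close>. It yields integrability for the
  completion \<open>lebesgue\<close>; continuity makes the composite Borel measurable, which brings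
  the result back to \<open>lborel\<close>.\<close>

lemma integrable_lborel_linear_comp:
  fixes f :: "real^2 \<Rightarrow> real" and h :: "real^2 \<Rightarrow> real^2"
  assumes int: "integrable lborel f" and cont: "continuous_on UNIV f"
    and lin: "linear h" and inj: "inj h"
  shows "integrable lborel (\<lambda>t. f (h t))"
proof -
  have surj: "h ` UNIV = UNIV"
    using lin inj linear_injective_imp_surjective by blast
  have "bounded_linear (vec :: real \<Rightarrow> real^1)"
    unfolding linear_conv_bounded_linear[symmetric] by (rule linear_vec)
  moreover have "f absolutely_integrable_on UNIV"
    using int by (simp add: integrable_completion set_integrable_def)
  ultimately have "((vec :: real \<Rightarrow> real^1) \<circ> f) absolutely_integrable_on (h ` UNIV)"
    unfolding surj by (intro absolutely_integrable_linear)
  then have "((vec :: real \<Rightarrow> real^1) \<circ> f \<circ> h) absolutely_integrable_on UNIV"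
    using absolutely_integrable_on_linear_image[OF lin,
        where f = "(vec :: real \<Rightarrow> real^1) \<circ> f" and S = UNIV]
      det_nz_iff_inj[OF lin] inj by blast
  then have "((\<lambda>x. x $ 1) \<circ> ((vec :: real \<Rightarrow> real^1) \<circ> f \<circ> h)) absolutely_integrable_on UNIV"
    by (rule absolutely_integrable_linear) (rule bounded_linear_vec_nth)
  then have "integrable lebesgue (\<lambda>t. f (h t))"
    by (simp add: o_def set_integrable_def)
  moreover have "continuous_on UNIV (\<lambda>t. f (h t))"
    using cont linear_continuous_on[of h UNIV] lin
    by (auto intro: continuous_on_compose2 simp: linear_conv_bounded_linear)
  then have "(\<lambda>t. f (h t)) \<in> borel_measurable lborel"
    by (simp add: borel_measurable_continuous_onI)
  ultimately show ?thesis
    by (simp add: integrable_completion)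
qed

section \<open>Polynomial decay and products of localized functions\<close>

lemma decay_linear_comp:
  fixes f :: "'a::euclidean_space \<Rightarrow> real" and h :: "'a \<Rightarrow> 'a"
  assumes dec: "\<And>t. (1 + norm t) ^ n * f t \<le> C" and nonneg: "\<And>t. 0 \<le> f t"
    and lin: "linear h" and inj: "inj h"
  obtains D where "\<And>t. (1 + norm t) ^ n * f (h t) \<le> D"
proof -
  \<comment> \<open>In finite dimension an injective linear map is bounded below, so decay in
    \<open>h t\<close> is also decay in \<open>t\<close>, at the price of a constant.\<close>
  obtain B where B: "B > 0" "\<And>x. B * norm x \<le> norm (h x)"
    using linear_inj_bounded_below_pos[OF lin inj] by blast
  \<comment> \<open>In \<open>1 + norm t \<le> K * (1 + norm (h t))\<close>, the bound
    \<open>K \<ge> 1\<close> takes care of the summand 1 and \<open>K * B \<ge> 1\<close> of the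
    norm.\<close>
  define K where "K = max 1 (1 / B)"
  have K: "K \<ge> 1" "K * B \<ge> 1" "K > 0"
    using B by (auto simp: K_def max_def field_simps)
  have "(1 + norm t) ^ n * f (h t) \<le> K ^ n * C" for t
  proof -
    have "norm t \<le> (K * B) * norm t"
      using K mult_right_mono[of 1 "K * B" "norm t"] by simp
    also have "\<dots> \<le> K * norm (h t)"
      using B(2)[of t] K by (simp add: mult.assoc)
    finally have "1 + norm t \<le> K * (1 + norm (h t))"
      using K by (simp add: algebra_simps)
    then have "(1 + norm t) ^ n \<le> K ^ n * (1 + norm (h t)) ^ n"
      by (metis add_nonneg_nonneg norm_ge_zero power_mono power_mult_distrib zero_le_one)
    then have "(1 + norm t) ^ n * f (h t) \<le> K ^ n * ((1 + norm (h t)) ^ n * f (h t))"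
      using mult_right_mono[OF _ nonneg[of "h t"]] unfolding mult.assoc[symmetric] by blast
    also have "\<dots> \<le> K ^ n * C"
      using dec K by (intro mult_left_mono) auto
    finally show ?thesis .
  qed
  then show ?thesis by (rule that)
qed

text \<open>By the triangle inequality, \<open>t\<close> is at least half of
  \<open>norm (u - v)\<close> away from \<open>u\<close> or from \<open>v\<close>. Which case occurs
  depends on \<open>t\<close>; the right side adds the bounds of both cases so that it can be
  integrated over \<open>t\<close>.\<close>

lemma localized_product_bound:
  fixes a b :: real and u v t :: "'a::real_normed_vector"
  assumes "0 \<le> a" "0 \<le> b"
    and "(1 + norm (t - u)) ^ n * a \<le> C" and "(1 + norm (t - v)) ^ n * b \<le> D"
  shows "(1 + norm (u - v)) ^ n * (a * b) \<le> 2 ^ n * (C * b + D * a)"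
proof -
  have tri: "norm (u - v) \<le> norm (t - u) + norm (t - v)"
    using norm_triangle_ineq4[of "t - v" "t - u"] by (simp add: algebra_simps)
  have C: "0 \<le> C" "0 \<le> D"
    using assms by (meson add_nonneg_nonneg mult_nonneg_nonneg norm_ge_zero order_trans
        zero_le_one zero_le_power)+
  consider "norm (u - v) \<le> 2 * norm (t - u)" | "norm (u - v) \<le> 2 * norm (t - v)"
    using tri by linarith
  then show ?thesis
  proof cases
    case 1
    then have "(1 + norm (u - v)) ^ n \<le> (2 * (1 + norm (t - u))) ^ n"
      by (intro power_mono) auto
    then have "(1 + norm (u - v)) ^ n * (a * b) \<le> (2 * (1 + norm (t - u))) ^ n * (a * b)"
      using assms by (intro mult_right_mono) auto
    also have "\<dots> = 2 ^ n * (((1 + norm (t - u)) ^ n * a) * b)"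
      by (simp only: power_mult_distrib mult_ac)
    also have "\<dots> \<le> 2 ^ n * (C * b)"
      using assms by (intro mult_left_mono mult_right_mono) auto
    also have "\<dots> \<le> 2 ^ n * (C * b + D * a)"
      using C assms by (intro mult_left_mono) auto
    finally show ?thesis .
  next
    case 2
    then have "(1 + norm (u - v)) ^ n \<le> (2 * (1 + norm (t - v))) ^ n"
      by (intro power_mono) auto
    then have "(1 + norm (u - v)) ^ n * (a * b) \<le> (2 * (1 + norm (t - v))) ^ n * (a * b)"
      using assms by (intro mult_right_mono) auto
    also have "\<dots> = 2 ^ n * (((1 + norm (t - v)) ^ n * b) * a)"
      by (simp only: power_mult_distrib mult_ac)
    also have "\<dots> \<le> 2 ^ n * (D * a)"
      using assms by (intro mult_left_mono mult_right_mono) auto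
    also have "\<dots> \<le> 2 ^ n * (C * b + D * a)"
      using C assms by (intro mult_left_mono) auto
    finally show ?thesis .
  qed
qed

text \<open>The pointwise bound is integrated over \<open>t\<close>. Translation invariance of the
  integral removes \<open>u\<close> and \<open>v\<close> from the right side, which makes the
  estimate uniform in the two positions.\<close>

lemma L2_inner_decay:
  fixes F G :: "real^2 \<Rightarrow> complex" and f g :: "real^2 \<Rightarrow> real"
  assumes f: "integrable lborel f" "\<And>t. (1 + norm t) ^ n * f t \<le> C" "\<And>t. norm (F t) = f (t - u)"
    and g: "integrable lborel g" "\<And>t. (1 + norm t) ^ n * g t \<le> D" "\<And>t. norm (G t) = g (t - v)"
  shows "(1 + norm (u - v)) ^ n * norm (L2_inner F G)
           \<le> 2 ^ n * (C * (LINT t|lborel. g t) + D * (LINT t|lborel. f t))"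
proof -
  note fu = integrable_lborel_translation[OF f(1), of u]
  note gv = integrable_lborel_translation[OF g(1), of v]
  have nonneg: "0 \<le> f (t - u)" "0 \<le> g (t - v)" for t
    using f(3)[of t] g(3)[of t] by (metis norm_ge_zero)+
  have bound: "(1 + norm (u - v)) ^ n * norm (F t * cnj (G t))
      \<le> 2 ^ n * (C * g (t - v) + D * f (t - u))" for t
    using localized_product_bound[OF nonneg(1) nonneg(2) f(2) g(2)] f(3) g(3)
    by (simp add: norm_mult)
  have "(1 + norm (u - v)) ^ n * norm (L2_inner F G)
      \<le> (1 + norm (u - v)) ^ n * (LINT t|lborel. norm (F t * cnj (G t)))"
    unfolding L2_inner_def by (intro mult_left_mono integral_norm_bound) auto
  also have "\<dots> = (LINT t|lborel. (1 + norm (u - v)) ^ n * norm (F t * cnj (G t)))"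
    by simp
  also have "\<dots> \<le> (LINT t|lborel. 2 ^ n * (C * g (t - v) + D * f (t - u)))"
  \<comment> \<open>Integrability is shown for the dominating function alone. A non-integrable left
    side would have integral 0 by convention, which is why nonnegativity of the dominating function
    is a separate goal.\<close>
  proof (rule integral_mono')
    show "integrable lborel (\<lambda>t. 2 ^ n * (C * g (t - v) + D * f (t - u)))"
      using fu(1) gv(1) by auto
  next
    fix t
    have "0 \<le> (1 + norm (u - v)) ^ n * norm (F t * cnj (G t))"
      by (intro mult_nonneg_nonneg zero_le_power) auto
    then show "0 \<le> 2 ^ n * (C * g (t - v) + D * f (t - u))"
      using bound[of t] by linarith
  qed (use bound in auto)
  also have "\<dots> = 2 ^ n * (C * (LINT t|lborel. g t) + D * (LINT t|lborel. f t))"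
    using fu gv by simp
  finally show ?thesis .
qed

section \<open>Envelopes of prototypes and of wave packets\<close>

lemma prototype_envelope:
  assumes proto: "prototype \<kappa>\<^sub>0 \<kappa> \<kappa>\<^sub>1 \<kappa>\<^sub>2 f" and n: "real n \<le> \<kappa>\<^sub>0"
  obtains C where "continuous_on UNIV (\<lambda>t. norm (f t))" "integrable lborel (\<lambda>t. norm (f t))"
    "\<And>t. (1 + norm t) ^ n * norm (f t) \<le> C"
proof -
  have "continuous_on UNIV f"
    using proto by (simp add: prototype_def)
  then have 1: "continuous_on UNIV (\<lambda>t. norm (f t))"
    by (intro continuous_intros)
  have "integrable lborel (multi_pdiff (0, 0) f)"
    using proto by (simp add: prototype_def)
  then have 2: "integrable lborel (\<lambda>t. norm (f t))"
    by (simp add: multi_pdiff_def)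
  obtain C where C: "\<And>t. (1 + norm t) powr \<kappa>\<^sub>0 * norm (f t) \<le> C"
    using proto unfolding prototype_def bdd_above_def by auto
  have "(1 + norm t) ^ n * norm (f t) \<le> C" for t
  proof -
    \<comment> \<open>The base is at least 1, so lowering the exponent from
      \<open>\<kappa>\<^sub>0\<close> to \<open>n\<close> only decreases the weight.\<close>
    have "(1 + norm t) ^ n = (1 + norm t) powr real n"
      by (subst powr_realpow) (auto intro: add_pos_nonneg)
    also have "\<dots> \<le> (1 + norm t) powr \<kappa>\<^sub>0"
      using n by (intro powr_mono) auto
    finally have "(1 + norm t) ^ n * norm (f t) \<le> (1 + norm t) powr \<kappa>\<^sub>0 * norm (f t)"
      by (intro mult_right_mono) auto
    then show ?thesis using C[of t] by linarith
  qed
  with 1 2 show ?thesis by (rule that)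
qed

lemma det_A_mat_nonzero: "det (A_mat \<alpha> \<beta> j) \<noteq> 0"
  by (simp add: A_mat_def det_2)

lemma det_R_mat: "det (R_mat \<beta> j l) = 1"
  by (simp add: R_mat_def det_2 flip: power2_eq_square)

text \<open>The order of quantifiers matters: \<open>f\<close> and \<open>C\<close> are chosen
  before \<open>k\<close>. The modulation has modulus 1 and the normalization depends on
  \<open>j\<close> only, so in the modulus \<open>k\<close> survives only through the
  position.\<close>

lemma wave_packet_envelope:
  assumes \<gamma>: "prototype \<kappa>\<^sub>0 \<kappa> \<kappa>\<^sub>1 \<kappa>\<^sub>2 \<gamma>" and \<psi>: "prototype \<kappa>\<^sub>0 \<kappa> \<kappa>\<^sub>1 \<kappa>\<^sub>2 \<psi>" and n: "real n \<le> \<kappa>\<^sub>0"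
  shows "\<exists>f C. integrable lborel f \<and> (\<forall>t. (1 + norm t) ^ n * f t \<le> C) \<and>
    (\<forall>k t. norm (wave_packet \<alpha> \<beta> \<delta> \<gamma> \<psi> (j, m, l, k) t) = f (t - position \<alpha> \<beta> \<delta> (j, m, l, k)))"
proof (cases "(j, m, l) = (0, 0, 0)")
  case True
  obtain C where "integrable lborel (\<lambda>t. norm (\<gamma> t))" "\<And>t. (1 + norm t) ^ n * norm (\<gamma> t) \<le> C"
    using prototype_envelope[OF \<gamma> n] by blast
  then show ?thesis
    using True by (intro exI[of _ "\<lambda>t. norm (\<gamma> t)"] exI[of _ C])
      (simp add: wave_packet_def position_def)
next
  case False
  obtain C where C: "continuous_on UNIV (\<lambda>t. norm (\<psi> t))" "integrable lborel (\<lambda>t. norm (\<psi> t))"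
      "\<And>t. (1 + norm t) ^ n * norm (\<psi> t) \<le> C"
    using prototype_envelope[OF \<psi> n] by blast
  define h where "h = (\<lambda>t. A_mat \<alpha> \<beta> j *v (matrix_inv (R_mat \<beta> j l) *v t))"
  have invA: "invertible (A_mat \<alpha> \<beta> j)" and invR: "invertible (R_mat \<beta> j l)"
    by (simp_all add: invertible_det_nz det_A_mat_nonzero det_R_mat)
  have lin: "linear h"
    unfolding h_def matrix_vector_mul_assoc by (rule matrix_vector_mul_linear)
  \<comment> \<open>\<open>matrix_inv\<close> is a choice among the matrices satisfying both inverse
    equations; \<open>someI_ex\<close> recovers these equations, so the inverse rotation is itself
    invertible.\<close>
  have "invertible (A_mat \<alpha> \<beta> j ** matrix_inv (R_mat \<beta> j l))"
    using invA someI_ex[OF invR[unfolded invertible_def]]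
    by (intro invertible_mult) (auto simp: invertible_def matrix_inv_def)
  then have inj: "inj h"
    unfolding h_def matrix_vector_mul_assoc using inj_matrix_vector_mult by blast
  obtain D where D: "\<And>t. (1 + norm t) ^ n * norm (\<psi> (h t)) \<le> D"
    using decay_linear_comp[of n "\<lambda>t. norm (\<psi> t)" C h] C(3) lin inj by auto
  define s where "s = sqrt \<bar>det (A_mat \<alpha> \<beta> j)\<bar>"
  have "integrable lborel (\<lambda>t. s * norm (\<psi> (h t)))"
    using integrable_lborel_linear_comp[OF C(2,1) lin inj] by simp
  moreover have "(1 + norm t) ^ n * (s * norm (\<psi> (h t))) \<le> s * D" for t
    using mult_left_mono[OF D, of s t] by (simp add: s_def mult_ac)
  moreover have "norm (wave_packet \<alpha> \<beta> \<delta> \<gamma> \<psi> (j, m, l, k) t)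
      = s * norm (\<psi> (h (t - position \<alpha> \<beta> \<delta> (j, m, l, k))))" for k t
    using False by (auto simp: wave_packet_def position_def norm_mult s_def h_def)
  ultimately show ?thesis
    by (intro exI[of _ "\<lambda>t. s * norm (\<psi> (h t))"] exI[of _ "s * D"]) simp
qed

section \<open>Comparison of the index distance with the positions\<close>

lemma wp_dist_le:
  obtains M where "\<And>k k'. 1 + wp_dist \<alpha> \<beta> \<delta> (j, m, l, k) (j', m', l', k') \<le>
    M * (1 + norm (position \<alpha> \<beta> \<delta> (j, m, l, k) - position \<alpha> \<beta> \<delta> (j', m', l', k')))" "1 \<le> M"
proof
  \<comment> \<open>Radius and orientation ignore the translation, so the 0 in the last slot is a
    placeholder and \<open>?S\<close> is constant once both triples are fixed.\<close>
  let ?S = "\<bar>radius \<alpha> (j, m, l, 0) - radius \<alpha> (j', m', l', 0)\<bar> +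
    \<bar>orientation \<beta> (j, m, l, 0) - orientation \<beta> (j', m', l', 0)\<bar>"
  fix k k'
  let ?d = "position \<alpha> \<beta> \<delta> (j, m, l, k) - position \<alpha> \<beta> \<delta> (j', m', l', k')"
  have "\<bar>?d $ 1\<bar> \<le> norm ?d" "\<bar>?d $ 2\<bar> \<le> norm ?d"
    by (rule component_le_norm_cart)+
  moreover have "0 \<le> ?S * norm ?d"
    by (intro mult_nonneg_nonneg) auto
  moreover have "wp_dist \<alpha> \<beta> \<delta> (j, m, l, k) (j', m', l', k') = ?S + \<bar>?d $ 1\<bar> + \<bar>?d $ 2\<bar>"
    by (simp only: wp_dist_def radius_def orientation_def prod.case)
  \<comment> \<open>The witness for \<open>M\<close> is \<open>2 + ?S\<close>: each coordinate
    difference is at most \<open>norm ?d\<close>, and the expanded product exceeds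
    \<open>1 + ?S + 2 * norm ?d\<close> by \<open>1 + ?S * norm ?d\<close>.\<close>
  moreover have "(2 + ?S) * (1 + norm ?d) = 2 + ?S + 2 * norm ?d + ?S * norm ?d"
    by (simp only: distrib_left distrib_right mult_1_right)
  ultimately show "1 + wp_dist \<alpha> \<beta> \<delta> (j, m, l, k) (j', m', l', k') \<le> (2 + ?S) * (1 + norm ?d)"
    by linarith
qed auto

lemma wave_packet_inner_fixed_scales:
  assumes \<gamma>: "prototype \<kappa>\<^sub>0 \<kappa> \<kappa>\<^sub>1 \<kappa>\<^sub>2 \<gamma>" and \<psi>: "prototype \<kappa>\<^sub>0 \<kappa> \<kappa>\<^sub>1 \<kappa>\<^sub>2 \<psi>" and n: "real n \<le> \<kappa>\<^sub>0"
  shows "\<exists>c. \<forall>k k'. norm (L2_inner (wave_packet \<alpha> \<beta> \<delta> \<gamma> \<psi> (j, m, l, k))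
      (wave_packet \<alpha> \<beta> \<delta> \<gamma> \<psi> (j', m', l', k')))
    \<le> c / (1 + wp_dist \<alpha> \<beta> \<delta> (j, m, l, k) (j', m', l', k')) ^ n"
proof -
  let ?w = "wave_packet \<alpha> \<beta> \<delta> \<gamma> \<psi>" and ?p = "position \<alpha> \<beta> \<delta>"
  obtain f C where f: "integrable lborel f" "\<And>t. (1 + norm t) ^ n * f t \<le> C"
      "\<And>k t. norm (?w (j, m, l, k) t) = f (t - ?p (j, m, l, k))"
    using wave_packet_envelope[OF \<gamma> \<psi> n] by metis
  obtain g D where g: "integrable lborel g" "\<And>t. (1 + norm t) ^ n * g t \<le> D"
      "\<And>k t. norm (?w (j', m', l', k) t) = g (t - ?p (j', m', l', k))"
    using wave_packet_envelope[OF \<gamma> \<psi> n] by metis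
  obtain M where M: "\<And>k k'. 1 + wp_dist \<alpha> \<beta> \<delta> (j, m, l, k) (j', m', l', k') \<le>
      M * (1 + norm (?p (j, m, l, k) - ?p (j', m', l', k')))" "1 \<le> M"
    using wp_dist_le by blast
  \<comment> \<open>This is the bound from \<open>L2_inner_decay\<close>; it is free of
    \<open>k\<close> and \<open>k'\<close> because the envelopes and their decay constants
    are.\<close>
  define E where "E = 2 ^ n * (C * (LINT t|lborel. g t) + D * (LINT t|lborel. f t))"
  have "norm (L2_inner (?w (j, m, l, k)) (?w (j', m', l', k')))
      \<le> M ^ n * E / (1 + wp_dist \<alpha> \<beta> \<delta> (j, m, l, k) (j', m', l', k')) ^ n" for k k'
  proof -
    let ?\<rho> = "wp_dist \<alpha> \<beta> \<delta> (j, m, l, k) (j', m', l', k')"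
    let ?d = "norm (?p (j, m, l, k) - ?p (j', m', l', k'))"
    let ?L = "norm (L2_inner (?w (j, m, l, k)) (?w (j', m', l', k')))"
    have \<rho>: "0 \<le> ?\<rho>"
      by (simp add: wp_dist_def)
    have "(1 + ?\<rho>) ^ n * ?L \<le> (M * (1 + ?d)) ^ n * ?L"
      using M(1) \<rho> by (intro mult_right_mono power_mono) auto
    also have "\<dots> = M ^ n * ((1 + ?d) ^ n * ?L)"
      by (simp only: power_mult_distrib mult_ac)
    also have "\<dots> \<le> M ^ n * E"
      unfolding E_def using M(2) by (intro mult_left_mono L2_inner_decay f g) auto
    finally show ?thesis
      using \<rho> by (simp add: field_simps add_pos_nonneg)
  qed
  then show ?thesis by blast
qed

section \<open>Uniformity over the finitely many scales\<close>

lemma finite_index_set_scales: "finite ((\<lambda>(j, m, l, k). (j, m, l)) ` index_set \<alpha> \<beta> jmax)"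
proof (rule finite_subset)
  \<comment> \<open>The ranges of \<open>l\<close> and \<open>m\<close> vary with the scale and the
    angle. Their unions up to \<open>jmax\<close> are still finite, so all triples lie in one
    product of finite sets.\<close>
  let ?L = "\<Union>j\<le>jmax. {..l_max \<beta> j}"
  let ?M = "\<Union>j\<le>jmax. \<Union>l\<in>?L. {..m_max \<alpha> \<beta> jmax j l}"
  show "(\<lambda>(j, m, l, k). (j, m, l)) ` index_set \<alpha> \<beta> jmax \<subseteq> insert (0, 0, 0) ({..jmax} \<times> ?M \<times> ?L)"
    unfolding index_set_def by fastforce
qed auto

theorem theorem1:
  fixes \<alpha> \<beta> \<delta> p\<^sub>0 \<kappa>\<^sub>0 \<epsilon> \<kappa> \<kappa>\<^sub>1 \<kappa>\<^sub>2 :: real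
    and jmax :: nat
    and \<gamma> \<psi> :: "real^2 \<Rightarrow> complex"
  assumes "0 \<le> \<beta>" and "\<beta> \<le> \<alpha>" and "\<alpha> < 1"
    and "1 \<le> jmax"
    and "0 < \<delta>"
    and "0 < p\<^sub>0" and "p\<^sub>0 \<le> 1"
    and "\<kappa>\<^sub>0 = 10 + 2 * inverse p\<^sub>0"
    and "0 < \<epsilon>" and "\<epsilon> < 1 / 32"
    and "10 \<le> \<kappa>" and "2 \<le> \<kappa>\<^sub>1" and "10 \<le> \<kappa>\<^sub>2"
    and "prototype \<kappa>\<^sub>0 \<kappa> \<kappa>\<^sub>1 \<kappa>\<^sub>2 \<gamma>"
    and "prototype \<kappa>\<^sub>0 \<kappa> \<kappa>\<^sub>1 \<kappa>\<^sub>2 \<psi>"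
    and "\<forall>\<xi> \<in> cball 0 4. fourier \<gamma> \<xi> \<noteq> 0"
    and "\<forall>\<xi>. \<xi> $ 1 \<in> {- \<epsilon>..1 + \<epsilon>} \<and> \<xi> $ 2 \<in> {- 1 - \<epsilon>..1 + \<epsilon>} \<longrightarrow> fourier \<psi> \<xi> \<noteq> 0"
    and "24 \<le> \<kappa>\<^sub>0" and "24 \<le> \<kappa>"
  shows "\<exists>c > 0. \<forall>i \<in> index_set \<alpha> \<beta> jmax. \<forall>i' \<in> index_set \<alpha> \<beta> jmax.
           norm (L2_inner (wave_packet \<alpha> \<beta> \<delta> \<gamma> \<psi> i) (wave_packet \<alpha> \<beta> \<delta> \<gamma> \<psi> i'))
             \<le> c * (1 + wp_dist \<alpha> \<beta> \<delta> i i') powi (-6)"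
proof -
  let ?I = "index_set \<alpha> \<beta> jmax" and ?w = "wave_packet \<alpha> \<beta> \<delta> \<gamma> \<psi>"
  let ?s = "\<lambda>(j, m, l, k). (j, m, l) :: nat \<times> nat \<times> nat"
  let ?S = "?s ` ?I"
  \<comment> \<open>Decay of order 6 is available because
    \<open>24 \<le> \<kappa>\<^sub>0\<close>.\<close>
  have "\<exists>c. \<forall>k k'. norm (L2_inner (?w (j, m, l, k)) (?w (j', m', l', k')))
      \<le> c / (1 + wp_dist \<alpha> \<beta> \<delta> (j, m, l, k) (j', m', l', k')) ^ 6" for j m l j' m' l'
    using wave_packet_inner_fixed_scales[of \<kappa>\<^sub>0 \<kappa> \<kappa>\<^sub>1 \<kappa>\<^sub>2 \<gamma> \<psi> 6] assms by simp
  \<comment> \<open>Phrased through the projection \<open>?s\<close>, so that choice turns the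
    constants into a function of the two triples.\<close>
  then have "\<forall>p p'. \<exists>c. \<forall>i i'. ?s i = p \<longrightarrow> ?s i' = p' \<longrightarrow>
      norm (L2_inner (?w i) (?w i')) \<le> c / (1 + wp_dist \<alpha> \<beta> \<delta> i i') ^ 6"
    by auto
  then obtain c where c: "\<forall>p p' i i'. ?s i = p \<longrightarrow> ?s i' = p' \<longrightarrow>
      norm (L2_inner (?w i) (?w i')) \<le> c p p' / (1 + wp_dist \<alpha> \<beta> \<delta> i i') ^ 6"
    unfolding choice_iff by blast
  \<comment> \<open>The sum of absolute values dominates each single constant, and the leading 1
    makes \<open>K\<close> positive.\<close>
  define K where "K = 1 + (\<Sum>(p, p')\<in>?S \<times> ?S. \<bar>c p p'\<bar>)"
  have fin: "finite (?S \<times> ?S)"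
    using finite_index_set_scales by blast
  have "c p p' \<le> K" if "p \<in> ?S" "p' \<in> ?S" for p p'
    using member_le_sum[of "(p, p')" "?S \<times> ?S" "\<lambda>(p, p'). \<bar>c p p'\<bar>"] that fin
    unfolding K_def by auto
  then have "norm (L2_inner (?w i) (?w i')) \<le> K * (1 + wp_dist \<alpha> \<beta> \<delta> i i') powi (-6)"
    if "i \<in> ?I" "i' \<in> ?I" for i i'
  proof -
    have "norm (L2_inner (?w i) (?w i')) \<le> c (?s i) (?s i') / (1 + wp_dist \<alpha> \<beta> \<delta> i i') ^ 6"
      using c by blast
    also have "\<dots> \<le> K / (1 + wp_dist \<alpha> \<beta> \<delta> i i') ^ 6"
      using that \<open>\<And>p p'. p \<in> ?S \<Longrightarrow> p' \<in> ?S \<Longrightarrow> c p p' \<le> K\<close>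
      by (intro divide_right_mono) auto
    finally show ?thesis
      by (simp add: power_int_def divide_inverse power_inverse)
  qed
  moreover have "K > 0"
    unfolding K_def by (intro add_pos_nonneg sum_nonneg) auto
  ultimately show ?thesis by blast
qed

end
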